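(* (a) Let $\langle K,R,\vDash\rangle$ be a Kripke model which is connected (for every $k\in K$ and all $k',k''\in R^+[k]$, $k'Rk''$ or $k''Rk'$) and whose satisfaction relation is formula persistent (for all $x,y\in K$ with $xRy$ and every formula $\chi$, $x\vDash\chi$ implies $y\vDash\chi$). Then for all formulas $\varphi,\psi,\theta$, the formula $[(\varphi\rightarrow\psi)\rightarrow\theta]\rightarrow[([\psi\rightarrow\varphi]\rightarrow\theta)\rightarrow\theta]$ holds at every node of the model. (b) Let $\langle K,R\rangle$ be a Kripke frame with $R$ reflexive and transitive, and suppose that every Kripke model $\langle K,R,\vDash\rangle$ on this frame whose satisfaction relation is persistent satisfies, at every node, all instances of $[(\varphi\rightarrow\psi)\rightarrow\theta]\rightarrow[([\psi\rightarrow\varphi]\rightarrow\theta)\rightarrow\theta]$. Then $R$ is connected.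
   Context: Formulas are built from a countably infinite set of atoms and the constant $\bot$ (falsity) using the binary connectives $\&$ and $\rightarrow$. A Kripke frame is a pair $\langle K,R\rangle$ with $R\subseteq K\times K$ a binary relation; a Kripke model on it is $\langle K,R,\vDash\rangle$ with $\vDash\subseteq K\times\mathsf{Atoms}$, extended to formulas by: $k\nvDash\bot$; $k\vDash\varphi\&\psi$ iff $k\vDash\varphi$ and $k\vDash\psi$; $k\vDash\varphi\rightarrow\psi$ iff for every $k'$ with $kRk'$, if $k'\vDash\varphi$ then $k'\vDash\psi$. A satisfaction relation is (atom) persistent if $x\vDash p$ and $xRy$ imply $y\vDash p$ for every atom $p$; for transitive $R$ this is equivalent to formula persistency (the same for all formulas). For $k\in K$, $R^n[k]=\{x\mid \exists y_1,\dots,y_{n-1}\,(kRy_1R\cdots Ry_{n-1}Rx)\}$ and $R^+[k]=\bigcup_{n\ge1}R^n[k]$. $R$ is connected if for every $k\in K$ and all $k',k''\in R^+[k]$, $k'Rk''$ or $k''Rk'$. *)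

theory Defs
  imports Main
begin

text \<open>The countably infinite set of atoms is represented by \<^typ>\<open>nat\<close>.\<close>

datatype fm =
    Atom nat
  | Falsity  (\<open>\<^bold>\<bottom>\<close>)
  | Conj fm fm  (infixr \<open>\<^bold>&\<close> 75)
  | Imp fm fm  (infixr \<open>\<^bold>\<rightarrow>\<close> 70)

text \<open>The set of nodes \<open>K\<close> is an explicit carrier, so that frames on arbitrary subsets of
  the node type are covered. As in the source, \<open>K\<close> is not required to be nonempty.\<close>

definition kripke_frame :: "'w set \<Rightarrow> ('w \<times> 'w) set \<Rightarrow> bool" where
  "kripke_frame K R \<longleftrightarrow> R \<subseteq> K \<times> K"

definition kripke_model :: "'w set \<Rightarrow> ('w \<times> 'w) set \<Rightarrow> ('w \<times> nat) set \<Rightarrow> bool" where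
  "kripke_model K R V \<longleftrightarrow> kripke_frame K R \<and> V \<subseteq> K \<times> UNIV"

text \<open>The clause for implication needs no guard \<open>k' \<in> K\<close>, because \<open>R \<subseteq> K \<times> K\<close> in every frame.\<close>

primrec sat :: "('w \<times> 'w) set \<Rightarrow> ('w \<times> nat) set \<Rightarrow> 'w \<Rightarrow> fm \<Rightarrow> bool" where
  "sat R V k (Atom p) \<longleftrightarrow> (k, p) \<in> V"
| "sat R V k \<^bold>\<bottom> \<longleftrightarrow> False"
| "sat R V k (\<phi> \<^bold>& \<psi>) \<longleftrightarrow> sat R V k \<phi> \<and> sat R V k \<psi>"
| "sat R V k (\<phi> \<^bold>\<rightarrow> \<psi>) \<longleftrightarrow> (\<forall>k'. (k, k') \<in> R \<longrightarrow> sat R V k' \<phi> \<longrightarrow> sat R V k' \<psi>)"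

definition atom_persistent :: "'w set \<Rightarrow> ('w \<times> 'w) set \<Rightarrow> ('w \<times> nat) set \<Rightarrow> bool" where
  "atom_persistent K R V \<longleftrightarrow>
     (\<forall>x\<in>K. \<forall>y\<in>K. \<forall>p. sat R V x (Atom p) \<and> (x, y) \<in> R \<longrightarrow> sat R V y (Atom p))"

definition formula_persistent :: "'w set \<Rightarrow> ('w \<times> 'w) set \<Rightarrow> ('w \<times> nat) set \<Rightarrow> bool" where
  "formula_persistent K R V \<longleftrightarrow>
     (\<forall>x\<in>K. \<forall>y\<in>K. \<forall>\<chi>. sat R V x \<chi> \<and> (x, y) \<in> R \<longrightarrow> sat R V y \<chi>)"

definition Rplus :: "('w \<times> 'w) set \<Rightarrow> 'w \<Rightarrow> 'w set" where
  "Rplus R k = (\<Union>n\<in>{1..}. (R ^^ n) `` {k})"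

definition connected_frame :: "'w set \<Rightarrow> ('w \<times> 'w) set \<Rightarrow> bool" where
  "connected_frame K R \<longleftrightarrow>
     (\<forall>k\<in>K. \<forall>k'\<in>Rplus R k. \<forall>k''\<in>Rplus R k. (k', k'') \<in> R \<or> (k'', k') \<in> R)"

definition lin_fm :: "fm \<Rightarrow> fm \<Rightarrow> fm \<Rightarrow> fm" where
  "lin_fm \<phi> \<psi> \<theta> =
     (((\<phi> \<^bold>\<rightarrow> \<psi>) \<^bold>\<rightarrow> \<theta>) \<^bold>\<rightarrow> (((\<psi> \<^bold>\<rightarrow> \<phi>) \<^bold>\<rightarrow> \<theta>) \<^bold>\<rightarrow> \<theta>))"

end

theory Submission
  imports Defs
begin

text \<open>
  (a) Connectedness makes every node above some other node reflexive. If \<open>\<phi> \<rightarrow> \<psi>\<close> and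
  \<open>\<psi> \<rightarrow> \<phi>\<close> both failed at a node, the two counterexamples above it would be comparable,
  contradicting persistency; so one of them holds there, and reflexivity yields \<open>\<theta>\<close>.
  (b) If \<open>a\<close> and \<open>b\<close> are incomparable nodes above \<open>k\<close>, let \<open>p\<close> and \<open>q\<close> hold exactly above \<open>a\<close>
  and \<open>b\<close> respectively, and let \<open>r\<close> hold exactly at the nodes not below both \<open>a\<close> and \<open>b\<close>.
  A node satisfying \<open>p \<rightarrow> q\<close> is not below \<open>a\<close>, one satisfying \<open>q \<rightarrow> p\<close> is not below \<open>b\<close>, so \<open>k\<close>
  satisfies both premises of the scheme but not \<open>r\<close>.
\<close>

lemma Rplus_eq_trancl: "Rplus R k = R\<^sup>+ `` {k}"
  by (auto simp: Rplus_def trancl_power Bex_def Suc_le_eq)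

lemma connected_persistent_imp_sat_lin_fm:
  assumes model: "kripke_model K R V" and conn: "connected_frame K R"
    and pers: "formula_persistent K R V" and k: "k \<in> K"
  shows "sat R V k (lin_fm \<phi> \<psi> \<theta>)"
proof -
  have RK: "R \<subseteq> K \<times> K"
    using model by (simp add: kripke_model_def kripke_frame_def)
  have comparable: "(x, y) \<in> R \<or> (y, x) \<in> R" if "(k, x) \<in> R\<^sup>+" "(k, y) \<in> R\<^sup>+" for x y
    using conn k that by (auto simp: connected_frame_def Rplus_eq_trancl)
  have persD: "sat R V y \<chi>" if "sat R V x \<chi>" "(x, y) \<in> R" for x y \<chi>
    using pers RK that unfolding formula_persistent_def by blast
  have "sat R V z \<theta>"
    if ky: "(k, y) \<in> R" and l: "sat R V y ((\<phi> \<^bold>\<rightarrow> \<psi>) \<^bold>\<rightarrow> \<theta>)"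
      and yz: "(y, z) \<in> R" and r: "sat R V z ((\<psi> \<^bold>\<rightarrow> \<phi>) \<^bold>\<rightarrow> \<theta>)" for y z
  proof -
    have kz: "(k, z) \<in> R\<^sup>+"
      using ky yz by auto
    \<comment> \<open>Take both arguments of \<open>comparable\<close> to be
      \<open>z\<close>.\<close>
    have zz: "(z, z) \<in> R"
      using comparable kz by blast
    have "sat R V z (\<phi> \<^bold>\<rightarrow> \<psi>) \<or> sat R V z (\<psi> \<^bold>\<rightarrow> \<phi>)"
    proof (rule ccontr)
      assume "\<not> ?thesis"
      then obtain a b where a: "(z, a) \<in> R" "sat R V a \<phi>" "\<not> sat R V a \<psi>"
        and b: "(z, b) \<in> R" "sat R V b \<psi>" "\<not> sat R V b \<phi>"
        by auto
      have "(a, b) \<in> R \<or> (b, a) \<in> R"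
        using comparable kz a(1) b(1) by (meson trancl.trancl_into_trancl)
      then show False
        using persD a b by blast
    qed
    then show ?thesis
    proof
      assume "sat R V z (\<phi> \<^bold>\<rightarrow> \<psi>)"
      then show ?thesis
        using l yz unfolding sat.simps(4)[of R V y] by blast
    next
      assume "sat R V z (\<psi> \<^bold>\<rightarrow> \<phi>)"
      then show ?thesis
        using r zz unfolding sat.simps(4)[of R V z "\<psi> \<^bold>\<rightarrow> \<phi>"] by blast
    qed
  qed
  then show ?thesis
    \<comment> \<open>The instance unfolds only the two outer implications, so the premises keep the
      shape of \<open>l\<close> and \<open>r\<close>.\<close>
    unfolding lin_fm_def sat.simps(4)[of R V _ "(_ \<^bold>\<rightarrow> _) \<^bold>\<rightarrow> _"] by blast
qed

lemma sat_lin_fm_imp_connected: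
  assumes frame: "kripke_frame K R" and refl: "refl_on K R" and trans: "trans R"
    and valid: "\<And>V \<phi> \<psi> \<theta> k. \<lbrakk>kripke_model K R V; atom_persistent K R V; k \<in> K\<rbrakk>
      \<Longrightarrow> sat R V k (lin_fm \<phi> \<psi> \<theta>)"
  shows "connected_frame K R"
proof (rule ccontr)
  assume "\<not> connected_frame K R"
  then obtain k a b where k: "k \<in> K" and "(k, a) \<in> R\<^sup>+" "(k, b) \<in> R\<^sup>+"
    and ab: "(a, b) \<notin> R" "(b, a) \<notin> R"
    by (auto simp: connected_frame_def Rplus_eq_trancl)
  then have ka: "(k, a) \<in> R" and kb: "(k, b) \<in> R"
    using trans by (simp_all add: trancl_id)
  have RK: "R \<subseteq> K \<times> K"
    using frame by (simp add: kripke_frame_def)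
  have kk: "(k, k) \<in> R" and aa: "(a, a) \<in> R" and bb: "(b, b) \<in> R"
    using refl k ka kb RK by (auto dest: refl_onD)
  define V where "V = {(x, 0::nat) | x. (a, x) \<in> R} \<union> {(x, 1) | x. (b, x) \<in> R}
    \<union> {(x, 2) | x. x \<in> K \<and> \<not> ((x, a) \<in> R \<and> (x, b) \<in> R)}"
  have p: "(x, 0) \<in> V \<longleftrightarrow> (a, x) \<in> R" and q: "(x, Suc 0) \<in> V \<longleftrightarrow> (b, x) \<in> R"
    and r: "(x, 2) \<in> V \<longleftrightarrow> x \<in> K \<and> \<not> ((x, a) \<in> R \<and> (x, b) \<in> R)" for x
    by (auto simp: V_def)
  have "kripke_model K R V"
    using frame RK by (auto simp: kripke_model_def V_def)
  \<comment> \<open>The third set is upward closed: by transitivity, the nodes below both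
    \<open>a\<close> and \<open>b\<close> form a downward closed set.\<close>
  moreover have "atom_persistent K R V"
    by (auto simp: atom_persistent_def V_def intro: transD[OF trans])
  ultimately have "sat R V k (lin_fm (Atom 0) (Atom 1) (Atom 2))"
    using k valid by blast
  \<comment> \<open>At a node below \<open>a\<close>, the premise evaluated at \<open>a\<close>
    would give \<open>(b, a) \<in> R\<close>.\<close>
  moreover have "sat R V k ((Atom 0 \<^bold>\<rightarrow> Atom 1) \<^bold>\<rightarrow> Atom 2)"
    using RK aa ab by (auto simp: p q r)
  moreover have "sat R V k ((Atom 1 \<^bold>\<rightarrow> Atom 0) \<^bold>\<rightarrow> Atom 2)"
    using RK bb ab by (auto simp: p q r)
  ultimately have "sat R V k (Atom 2)"
    using kk unfolding lin_fm_def sat.simps(4)[of R V _ "(_ \<^bold>\<rightarrow> _) \<^bold>\<rightarrow> _"] by blast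
  then show False
    using ka kb by (simp add: r)
qed

theorem theorem6:
  shows "(\<forall>(K :: 'w set) R V.
            kripke_model K R V \<and> connected_frame K R \<and> formula_persistent K R V \<longrightarrow>
            (\<forall>\<phi> \<psi> \<theta>. \<forall>k\<in>K. sat R V k (lin_fm \<phi> \<psi> \<theta>)))
       \<and> (\<forall>(K :: 'w set) R.
            kripke_frame K R \<and> refl_on K R \<and> trans R \<and>
            (\<forall>V. kripke_model K R V \<and> atom_persistent K R V \<longrightarrow>
                 (\<forall>\<phi> \<psi> \<theta>. \<forall>k\<in>K. sat R V k (lin_fm \<phi> \<psi> \<theta>))) \<longrightarrow>
            connected_frame K R)"
  by (auto intro: connected_persistent_imp_sat_lin_fm sat_lin_fm_imp_connected)

end
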